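(* Let $n\ge 3$, $b<-2$, and let $\widetilde b\in\mathbb{R}$ be such that $\widetilde T_n=\widetilde T_n(b,\widetilde b)$ is invertible. Put $b_+=-b>2$ and $\widetilde b_+=-\widetilde b$, and let $\widetilde t^{-1}_{i,j,+}$ be the $(i,j)$ entry of the inverse of $\widetilde T_n(b_+,\widetilde b_+)$. Then for all $1\le j\le i\le n$, $$\widetilde t^{-1}_{i,j}=C(\gamma_{n+1-i}+\beta\gamma_{n-i})(\gamma_j+\beta\gamma_{j-1})=(-1)^{i-j-1}\,\widetilde t^{-1}_{i,j,+},\qquad C=\frac{\gamma_{n+1}}{\gamma_1\left((\gamma_{n+1}+\beta\gamma_n)^2-(\beta\gamma_1)^2\right)},$$ where $\beta=\widetilde b-b$.
   Context: For an integer $n\ge 3$ and real $b,\widetilde b$, $\widetilde T_n(b,\widetilde b)$ is the $n\times n$ real symmetric tridiagonal matrix with diagonal entries $(\widetilde b,b,b,\dots,b,\widetilde b)$ (first and last equal to $\widetilde b$, all others equal to $b$) and all sub- and superdiagonal entries equal to $-1$. $\widetilde t^{-1}_{i,j}$ denotes the $(i,j)$ entry of $\widetilde T_n(b,\widetilde b)^{-1}$. For $b<-2$ put $r_1=\tfrac12(b+\sqrt{b^2-4})$, $r_2=\tfrac12(b-\sqrt{b^2-4})$ and $\gamma_k=r_1^k-r_2^k$ for integers $k\ge 0$. *)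

theory Defs
  imports Complex_Main "Jordan_Normal_Form.Gauss_Jordan_Elimination"
begin

text \<open>Matrices of the library are indexed from 0, so the first and the last diagonal
  positions are 0 and n - 1.\<close>

definition T_tilde :: "nat \<Rightarrow> real \<Rightarrow> real \<Rightarrow> real mat" where
  "T_tilde n b bt = mat n n (\<lambda>(i, j).
     if i = j then (if i = 0 \<or> i = n - 1 then bt else b)
     else if i = Suc j \<or> j = Suc i then -1
     else 0)"

text \<open>Entry of the inverse matrix in 1-based indexing. It is meaningful for invertible
  A and indices between 1 and the dimension; for a singular A, mat_inverse A
  is None and the value is unspecified.\<close>

definition inv_entry :: "real mat \<Rightarrow> nat \<Rightarrow> nat \<Rightarrow> real" where
  "inv_entry A i j = the (mat_inverse A) $$ (i - 1, j - 1)"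

definition r1 :: "real \<Rightarrow> real" where
  "r1 b = (b + sqrt (b\<^sup>2 - 4)) / 2"

definition r2 :: "real \<Rightarrow> real" where
  "r2 b = (b - sqrt (b\<^sup>2 - 4)) / 2"

definition gam :: "real \<Rightarrow> nat \<Rightarrow> real" where
  "gam b k = r1 b ^ k - r2 b ^ k"

end

theory Submission
  imports Defs "Jordan_Normal_Form.Determinant"
begin

text \<open>The sequence \<open>\<gamma>\<close> satisfies \<open>b \<gamma>\<^sub>k\<^sub>+\<^sub>1 = \<gamma>\<^sub>k + \<gamma>\<^sub>k\<^sub>+\<^sub>2\<close>, so \<open>v\<^sub>k = \<gamma>\<^sub>k\<^sub>+\<^sub>1 + \<beta> \<gamma>\<^sub>k\<close> solves the
  homogeneous equation together with the boundary condition of the first row, and its reflection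
  solves the one of the last row. The inverse is therefore the discrete Green function
  \<open>v\<^bsub>min i j\<^esub> v\<^bsub>n - 1 - max i j\<^esub> / W\<close>, where \<open>W\<close> is the constant Casoratian; if \<open>W = 0\<close>, then \<open>v\<close> lies
  in the kernel. Conjugation with the alternating signs \<open>(-1)\<^sup>i\<close> turns \<open>- T\<close> into the matrix with
  parameters \<open>- b\<close> and \<open>- bt\<close>.\<close>

section \<open>The Green function of the tridiagonal matrix\<close>

lemma T_tilde_carrier [simp]: "T_tilde n b bt \<in> carrier_mat n n"
  by (simp add: T_tilde_def)

lemma T_tilde_row_sum:
  fixes f :: "nat \<Rightarrow> real"
  assumes "i < n" and "n \<ge> 2"
  shows "(\<Sum>k = 0..<n. T_tilde n b bt $$ (i, k) * f k)
    = (if i = 0 then bt * f 0 - f 1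
       else if i = n - 1 then bt * f (n - 1) - f (n - 2)
       else b * f i - f (i - 1) - f (i + 1))"
proof -
  define d where "d = (if i = 0 \<or> i = n - 1 then bt else b)"
  have "(\<Sum>k = 0..<n. T_tilde n b bt $$ (i, k) * f k)
    = (\<Sum>k = 0..<n. (if k = i then d * f k else 0)
         + (if k = Suc i then - f k else 0)
         + (if Suc k = i then - f k else 0))"
    using assms by (intro sum.cong) (auto simp: T_tilde_def d_def)
  also have "\<dots> = d * f i + (if Suc i < n then - f (Suc i) else 0)
      + (\<Sum>k = 0..<n. if Suc k = i then - f k else 0)"
    using assms by (simp add: sum.distrib)
  also have "(\<Sum>k = 0..<n. if Suc k = i then - f k else 0) = (if i = 0 then 0 else - f (i - 1))"
    using assms by (cases i) auto
  finally show ?thesis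
    using assms by (auto simp: d_def numeral_2_eq_2)
qed

text \<open>Column \<open>q\<close> is a multiple of \<open>v\<close> up to the diagonal and of
  \<open>w\<close> from there on, so every other row annihilates it; in row \<open>q\<close> the two
  pieces meet and leave the Casoratian \<open>W\<close>.\<close>

lemma T_tilde_mult_green:
  fixes v w :: "nat \<Rightarrow> real"
  assumes "n \<ge> 2" and "W \<noteq> 0"
    and v0: "bt * v 0 = v 1"
    and v: "\<And>p. p + 2 < n \<Longrightarrow> b * v (p + 1) = v p + v (p + 2)"
    and w1: "bt * w (n - 1) = w (n - 2)"
    and w: "\<And>p. p + 2 < n \<Longrightarrow> b * w (p + 1) = w p + w (p + 2)"
    and W: "\<And>p. p + 1 < n \<Longrightarrow> v (p + 1) * w p - v p * w (p + 1) = W"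
  shows "T_tilde n b bt * mat n n (\<lambda>(p, q). v (min p q) * w (max p q) / W) = 1\<^sub>m n"
    (is "_ * ?G = _")
proof (rule eq_matI)
  fix i q assume "i < dim_row (1\<^sub>m n :: real mat)" "q < dim_col (1\<^sub>m n :: real mat)"
  then have i: "i < n" and q: "q < n" by auto
  define f where "f k = v (min k q) * w (max k q)" for k
  have "(T_tilde n b bt * ?G) $$ (i, q) = (\<Sum>k = 0..<n. T_tilde n b bt $$ (i, k) * f k) / W"
    using i q by (simp add: scalar_prod_def f_def sum_divide_distrib T_tilde_def)
  also have "(\<Sum>k = 0..<n. T_tilde n b bt $$ (i, k) * f k) = (if i = q then W else 0)"
  proof -
    consider "i = 0" | "i = n - 1" "i \<noteq> 0" | p where "i = p + 1" "p + 2 < n"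
      using i by (cases i) (auto, fastforce)
    then show ?thesis
    proof cases
      case 1
      have "bt * f 0 - f 1 = (if q = 0 then W else 0)"
      proof (cases "q = 0")
        case True
        then show ?thesis using W[of 0] v0 \<open>n \<ge> 2\<close>
          by (simp add: f_def flip: mult.assoc)
      next
        case False
        then have "min 1 q = 1" "max 1 q = q" by auto
        then show ?thesis using v0 False by (simp add: f_def flip: v0)
      qed
      then show ?thesis using 1 T_tilde_row_sum[OF i \<open>n \<ge> 2\<close>] by simp
    next
      case 2
      define m where "m = n - 2"
      have m: "n = m + 2" using \<open>n \<ge> 2\<close> by (simp add: m_def)
      have "bt * f (m + 1) - f m = (if q = m + 1 then W else 0)"
      proof (cases "q = m + 1")
        case True
        then show ?thesis using W[of m] w1 m
          by (simp add: f_def mult.left_commute[of bt])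
      next
        case False
        then have "min m q = q" "max m q = m" "min (m + 1) q = q" "max (m + 1) q = m + 1"
          using q m by auto
        then show ?thesis using w1 m False by (simp add: f_def flip: w1)
      qed
      then show ?thesis using 2 m T_tilde_row_sum[OF i \<open>n \<ge> 2\<close>] by auto
    next
      case 3
      have "b * f (p + 1) - f p - f (p + 2) = (if q = p + 1 then W else 0)"
      proof (cases q "p + 1" rule: linorder_cases)
        case less
        then have *: "f p = v q * w p" "f (p + 1) = v q * w (p + 1)" "f (p + 2) = v q * w (p + 2)"
          by (simp_all add: f_def min_absorb2 max_absorb1)
        have "b * f (p + 1) - f p - f (p + 2) = v q * (b * w (p + 1) - w p - w (p + 2))"
          unfolding * by (simp add: algebra_simps)
        then show ?thesis using w[OF 3(2)] less by simp
      next
        case equal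
        then have *: "f p = v p * w (p + 1)" "f (p + 1) = v (p + 1) * w (p + 1)"
            "f (p + 2) = v (p + 1) * w (p + 2)"
          by (auto simp: f_def)
        \<comment> \<open>Adding and subtracting \<open>v (p + 1) * w p\<close> completes the
          recurrence of \<open>w\<close>; the Casoratian remains.\<close>
        have "b * f (p + 1) - f p - f (p + 2)
            = v (p + 1) * (b * w (p + 1) - w p - w (p + 2))
              + (v (p + 1) * w p - v p * w (p + 1))"
          unfolding * by (simp add: algebra_simps)
        then show ?thesis using w[OF 3(2)] W[of p] 3 equal by simp
      next
        case greater
        then have *: "f p = v p * w q" "f (p + 1) = v (p + 1) * w q" "f (p + 2) = v (p + 2) * w q"
          by (simp_all add: f_def min_absorb1 max_absorb2)
        have "b * f (p + 1) - f p - f (p + 2) = w q * (b * v (p + 1) - v p - v (p + 2))"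
          unfolding * by (simp add: algebra_simps)
        then show ?thesis using v[OF 3(2)] greater by simp
      qed
      then show ?thesis using 3 T_tilde_row_sum[OF i \<open>n \<ge> 2\<close>] by auto
    qed
  qed
  finally show "(T_tilde n b bt * ?G) $$ (i, q) = 1\<^sub>m n $$ (i, q)"
    using i q \<open>W \<noteq> 0\<close> by simp
qed (simp_all add: T_tilde_def)

text \<open>Over a field a right inverse of a square matrix is two-sided and unique, so exhibiting
  one both rules out \<open>None\<close> and pins down the value of
  \<open>mat_inverse\<close>.\<close>

lemma right_inverse_imp_mat_inverse:
  fixes A B :: "'a :: field mat"
  assumes A: "A \<in> carrier_mat n n" and B: "B \<in> carrier_mat n n" and AB: "A * B = 1\<^sub>m n"
  shows "invertible_mat A" and "mat_inverse A = Some B"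
proof -
  have BA: "B * A = 1\<^sub>m n"
    using mat_mult_left_right_inverse[OF A B AB] .
  show "invertible_mat A"
    using A B AB BA by (auto simp: invertible_mat_def inverts_mat_def intro!: exI[of _ B])
  show "mat_inverse A = Some B"
  proof (cases "mat_inverse A")
    case None
    then show ?thesis
      using mat_inverse(1)[OF A None, of "()"] A B AB BA
      by (auto simp: Units_def ring_mat_simps)
  next
    case (Some C)
    from mat_inverse(2)[OF A Some] have C: "C * A = 1\<^sub>m n" "C \<in> carrier_mat n n" by auto
    have "C = C * (A * B)" using C AB by simp
    also have "\<dots> = (C * A) * B" using assoc_mult_mat[OF C(2) A B] by simp
    finally have "C = B" using C B by simp
    then show ?thesis using Some by simp
  qed
qed

text \<open>With D the diagonal matrix of the signs (-1)^i, the factors are -DAD and -DBD, and D^2 =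
  1.\<close>

lemma mult_mat_alternating_conj:
  fixes A B :: "'a :: comm_ring_1 mat"
  assumes "A \<in> carrier_mat n n" and "B \<in> carrier_mat n n" and AB: "A * B = 1\<^sub>m n"
  shows "mat n n (\<lambda>(i, j). - ((-1) ^ (i + j) * A $$ (i, j)))
       * mat n n (\<lambda>(i, j). - ((-1) ^ (i + j) * B $$ (i, j))) = 1\<^sub>m n" (is "?L = _")
proof (rule eq_matI)
  fix i j assume "i < dim_row (1\<^sub>m n :: 'a mat)" "j < dim_col (1\<^sub>m n :: 'a mat)"
  then have ij: "i < n" "j < n" by auto
  have "?L $$ (i, j) = (\<Sum>k = 0..<n. (-1) ^ (i + j) * (A $$ (i, k) * B $$ (k, j)))"
  proof -
    have "(-1) ^ (i + k) * a * ((-1) ^ (k + j) * c) = (-1) ^ (i + j) * (a * c)" for k and a c :: 'a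
      by (cases "even i"; cases "even k"; cases "even j") simp_all
    then show ?thesis using ij by (auto simp: scalar_prod_def intro!: sum.cong)
  qed
  also have "\<dots> = (-1) ^ (i + j) * (A * B) $$ (i, j)"
    using ij assms(1,2) by (simp add: scalar_prod_def sum_distrib_left)
  also have "\<dots> = 1\<^sub>m n $$ (i, j)"
    using ij unfolding AB by auto
  finally show "?L $$ (i, j) = 1\<^sub>m n $$ (i, j)" .
qed simp_all

text \<open>The sign is 1 on the diagonal and -1 next to it, so the extra negation flips the
  diagonal and keeps the off-diagonal entries -1.\<close>

lemma T_tilde_uminus:
  "T_tilde n (- b) (- bt) = mat n n (\<lambda>(i, j). - ((-1) ^ (i + j) * T_tilde n b bt $$ (i, j)))"
  by (rule eq_matI) (auto simp: T_tilde_def)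

text \<open>The hypotheses put \<open>vec n v\<close> in the kernel, and
  \<open>v 0 \<noteq> 0\<close> makes it nonzero. Serves to deduce a nonzero Casoratian from
  invertibility.\<close>

lemma T_tilde_singular:
  fixes v :: "nat \<Rightarrow> real"
  assumes n: "n \<ge> 2"
    and v0: "bt * v 0 = v 1"
    and v: "\<And>p. p + 2 < n \<Longrightarrow> b * v (p + 1) = v p + v (p + 2)"
    and vn: "bt * v (n - 1) = v (n - 2)"
    and "v 0 \<noteq> 0"
  shows "\<not> invertible_mat (T_tilde n b bt)"
proof
  assume "invertible_mat (T_tilde n b bt)"
  then obtain B where "B * T_tilde n b bt = 1\<^sub>m (dim_row B)"
    and "T_tilde n b bt * B = 1\<^sub>m n"
    by (auto simp: invertible_mat_def inverts_mat_def T_tilde_def)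
  then have B: "B \<in> carrier_mat n n" and BT: "B * T_tilde n b bt = 1\<^sub>m n"
    by (metis T_tilde_carrier carrier_matD(2) carrier_matI index_mult_mat(2,3) index_one_mat(2,3))+
  have T0: "T_tilde n b bt *\<^sub>v vec n v = 0\<^sub>v n"
  proof (rule eq_vecI)
    fix i assume "i < dim_vec (0\<^sub>v n :: real vec)"
    then have i: "i < n" by simp
    have "(T_tilde n b bt *\<^sub>v vec n v) $ i = (\<Sum>k = 0..<n. T_tilde n b bt $$ (i, k) * v k)"
      using i by (simp add: scalar_prod_def T_tilde_def)
    also have "\<dots> = 0"
      using T_tilde_row_sum[OF i n, of b bt v] v0 vn v[of "i - 1"] i by auto
    finally show "(T_tilde n b bt *\<^sub>v vec n v) $ i = 0\<^sub>v n $ i" using i by simp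
  qed (simp add: T_tilde_def)
  have "vec n v = (B * T_tilde n b bt) *\<^sub>v vec n v" using BT by simp
  also have "\<dots> = B *\<^sub>v 0\<^sub>v n"
    using T0 B assoc_mult_mat_vec[OF B T_tilde_carrier, of "vec n v"] by simp
  also have "\<dots> = 0\<^sub>v n" using B by auto
  finally have "vec n v $ 0 = 0\<^sub>v n $ 0" by simp
  then show False using n \<open>v 0 \<noteq> 0\<close> by simp
qed

section \<open>The sequence \<open>\<gamma>\<close>\<close>

lemma r1_plus_r2: "r1 b + r2 b = b"
  by (simp add: r1_def r2_def field_simps)

lemma r1_times_r2:
  assumes "b < -2"
  shows "r1 b * r2 b = 1"
proof -
  have "b\<^sup>2 \<ge> 4" using assms power_mono[of 2 "- b" 2] by simp
  then have "sqrt (b\<^sup>2 - 4) * sqrt (b\<^sup>2 - 4) = b\<^sup>2 - 4" by simp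
  then show ?thesis by (simp add: r1_def r2_def field_simps power2_eq_square)
qed

lemma gam_0: "gam b 0 = 0"
  by (simp add: gam_def)

text \<open>Having sum \<open>b\<close> and product 1, \<open>r1 b\<close> and \<open>r2 b\<close>
  are the roots of x^2 - b x + 1.\<close>

lemma gam_rec:
  assumes "b < -2"
  shows "gam b (k + 2) = b * gam b (k + 1) - gam b k"
proof -
  have "x ^ (k + 2) = b * x ^ (k + 1) - x ^ k" if "x = r1 b \<or> x = r2 b" for x
  proof -
    have "x * x = b * x - 1"
    proof -
      have "x * x = (r1 b + r2 b) * x - r1 b * r2 b" using that by (auto simp: algebra_simps)
      then show ?thesis by (simp only: r1_plus_r2 r1_times_r2[OF assms])
    qed
    then have "x ^ k * (x * x) = x ^ k * (b * x - 1)" by simp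
    then show ?thesis by (simp add: algebra_simps power2_eq_square)
  qed
  from this[of "r1 b"] this[of "r2 b"] show ?thesis by (simp add: gam_def algebra_simps)
qed

text \<open>Neither root is positive and \<open>r2 b\<close> has the strictly larger modulus, so
  their powers differ in modulus.\<close>

lemma gam_nonzero:
  assumes "b < -2" and "k > 0"
  shows "gam b k \<noteq> 0"
proof -
  have "b\<^sup>2 > 4" using assms power_strict_mono[of 2 "- b" 2] by simp
  then have "sqrt (b\<^sup>2 - 4) > 0" by simp
  moreover have "sqrt (b\<^sup>2 - 4) \<le> - b"
    using assms by (intro real_le_lsqrt) auto
  ultimately have "r1 b \<le> 0" and "r2 b < r1 b" by (simp_all add: r1_def r2_def)
  then have "\<bar>r1 b\<bar> < \<bar>r2 b\<bar>" by simp
  then have "\<bar>r1 b\<bar> ^ k < \<bar>r2 b\<bar> ^ k" using assms by (intro power_strict_mono) auto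
  then show ?thesis by (auto simp: gam_def simp flip: power_abs)
qed

text \<open>A Cassini-type identity; it lets \<open>gam b (n + 1)\<close> be factored out of the
  denominator of \<open>C\<close>.\<close>

lemma gam_square_diff:
  assumes "b < -2"
  shows "(gam b (k + 1))\<^sup>2 - (gam b 1)\<^sup>2 = gam b (k + 2) * gam b k"
proof -
  \<comment> \<open>Here \<open>s\<close> and \<open>t\<close> stand for the \<open>k\<close>-th
    powers of the roots; the last summand vanishes because \<open>r1 b * r2 b = 1\<close> gives
    \<open>s * t = 1\<close>.\<close>
  have "(x * s - y * t)\<^sup>2 - (x - y)\<^sup>2
      = (x * x * s - y * y * t) * (s - t) + (s * t - 1) * (x - y)\<^sup>2" for x y s t :: real
    by (simp add: power2_eq_square algebra_simps)
  from this[of "r1 b" "r1 b ^ k" "r2 b" "r2 b ^ k"]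
  show ?thesis using r1_times_r2[OF assms]
    by (simp add: gam_def mult.assoc flip: power_mult_distrib)
qed

section \<open>The explicit inverse\<close>

theorem mainTheorem2:
  fixes n :: nat and b bt :: real
  assumes "n \<ge> 3"
    and "b < -2"
    and "invertible_mat (T_tilde n b bt)"
  shows "let \<beta> = bt - b;
             b_plus = - b;
             bt_plus = - bt;
             \<gamma> = gam b;
             C = \<gamma> (n + 1) / (\<gamma> 1 * ((\<gamma> (n + 1) + \<beta> * \<gamma> n)\<^sup>2 - (\<beta> * \<gamma> 1)\<^sup>2))
         in invertible_mat (T_tilde n b_plus bt_plus) \<and>
            (\<forall>i j. 1 \<le> j \<and> j \<le> i \<and> i \<le> n \<longrightarrow>
               inv_entry (T_tilde n b bt) i j
                 = C * (\<gamma> (n + 1 - i) + \<beta> * \<gamma> (n - i)) * (\<gamma> j + \<beta> * \<gamma> (j - 1)) \<and>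
               C * (\<gamma> (n + 1 - i) + \<beta> * \<gamma> (n - i)) * (\<gamma> j + \<beta> * \<gamma> (j - 1))
                 = (-1) powi (int i - int j - 1) * inv_entry (T_tilde n b_plus bt_plus) i j)"
proof -
  note rec = gam_rec[OF assms(2)]
  define \<beta> where "\<beta> = bt - b"
  \<comment> \<open>At \<open>p = j - 1\<close> this is the second factor of the claimed entry; the
    reflection \<open>w\<close> at \<open>i - 1\<close> is the first.\<close>
  define v where "v p = gam b (p + 1) + \<beta> * gam b p" for p
  define w where "w p = v (n - 1 - p)" for p
  \<comment> \<open>The Casoratian at \<open>p = 0\<close>, where \<open>v 1 = bt * v 0\<close>. In
    this form it vanishes only if \<open>v\<close> also satisfies the equation of the last
    row.\<close>
  define W where "W = gam b 1 * (bt * v (n - 1) - v (n - 2))"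
  define C where
    "C = gam b (n + 1) / (gam b 1 * ((gam b (n + 1) + \<beta> * gam b n)\<^sup>2 - (\<beta> * gam b 1)\<^sup>2))"
  have g1: "gam b 1 \<noteq> 0" and gn: "gam b (n + 1) \<noteq> 0"
    using gam_nonzero[OF assms(2)] by auto
  have n2: "n \<ge> 2" using assms(1) by simp
  have v0: "v 0 = gam b 1" by (simp add: v_def gam_0)
  have v1: "bt * v 0 = v 1"
    using rec[of 0] by (simp add: v_def gam_0 \<beta>_def algebra_simps)
  have v: "b * v (p + 1) = v p + v (p + 2)" for p
  proof -
    have "v p + v (p + 2) = (gam b p + gam b (p + 2)) * \<beta> + (gam b (p + 1) + gam b (p + 1 + 2))"
      by (simp add: v_def algebra_simps)
    then show ?thesis unfolding rec by (simp add: v_def algebra_simps)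
  qed
  have wn: "bt * w (n - 1) = w (n - 2)"
    using v1 n2 by (simp add: w_def numeral_2_eq_2)
  have w: "b * w (p + 1) = w p + w (p + 2)" if "p + 2 < n" for p
  proof -
    \<comment> \<open>The recurrence of \<open>w\<close> at \<open>p\<close> is that of
      \<open>v\<close> at the mirrored position \<open>m\<close>.\<close>
    define m where "m = n - p - 3"
    have "n = m + p + 3" using that by (simp add: m_def)
    then show ?thesis using v[of m] by (simp add: w_def numeral_3_eq_3)
  qed
  have W: "v (p + 1) * w p - v p * w (p + 1) = W" if "p + 1 < n" for p
    using that
  proof (induction p)
    case 0
    have "v 1 = bt * gam b 1" using v0 v1 by simp
    then show ?case using v0 by (simp add: W_def w_def numeral_2_eq_2 algebra_simps)
  next
    case (Suc p)
    have "v (p + 2) * w (p + 1) - v (p + 1) * w (p + 2) = v (p + 1) * w p - v p * w (p + 1)"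
    proof -
      \<comment> \<open>Eliminating \<open>v2\<close> and \<open>w2\<close> produces
        \<open>b * v1 * w1\<close> twice with opposite signs.\<close>
      have "v2 * w1 - v1 * w2 = v1 * w0 - v0 * w1" if "b * v1 = v0 + v2" "b * w1 = w0 + w2"
        for v0 v1 v2 w0 w1 w2 :: real
      proof -
        have "v2 = b * v1 - v0" "w2 = b * w1 - w0" using that by auto
        then show ?thesis by (simp only:) (simp add: algebra_simps)
      qed
      from this[OF v w] show ?thesis using Suc.prems by simp
    qed
    then show ?case using Suc by simp
  qed
  have W0: "W \<noteq> 0"
    using T_tilde_singular[OF n2 v1 v] assms(3) g1 v0 by (auto simp: W_def)
  have C: "C = 1 / W"
  proof -
    obtain m where m: "n = m + 1" using n2 by (cases n) auto
    have "(gam b (n + 1) + \<beta> * gam b n)\<^sup>2 - (\<beta> * gam b 1)\<^sup>2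
        = gam b (n + 1) * (bt * v (n - 1) - v (n - 2))"
    proof -
      obtain l where l: "m = l + 1" using n2 m by (cases m) auto
      have "bt * v (n - 1) - v (n - 2) = gam b (m + 2) + 2 * \<beta> * gam b (m + 1) + \<beta>\<^sup>2 * gam b m"
      proof -
        \<comment> \<open>Since \<open>bt = b + \<beta>\<close>, the recurrence turns the residual
          of the last row into \<open>v n + \<beta> * v (n - 1)\<close>.\<close>
        have "bt * v (n - 1) - v (n - 2) = v (l + 2) + \<beta> * v (l + 1)"
          using v[of l] by (simp add: m l \<beta>_def algebra_simps)
        then show ?thesis by (simp add: v_def l power2_eq_square algebra_simps)
      qed
      \<comment> \<open>Used with \<open>x\<close>, \<open>y\<close>, \<open>z\<close>,
        \<open>t\<close> the values of \<open>gam b\<close> at \<open>n + 1\<close>,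
        \<open>n\<close>, 1 and \<open>n - 1\<close>.\<close>
      moreover have "(x + \<beta> * y)\<^sup>2 - (\<beta> * z)\<^sup>2 = x * (x + 2 * \<beta> * y + \<beta>\<^sup>2 * t)"
        if "y\<^sup>2 - z\<^sup>2 = x * t" for x y z t :: real
      proof -
        have "(x + \<beta> * y)\<^sup>2 - (\<beta> * z)\<^sup>2 = x * (x + 2 * \<beta> * y) + \<beta>\<^sup>2 * (y\<^sup>2 - z\<^sup>2)"
          by (simp add: power2_eq_square algebra_simps)
        then show ?thesis unfolding that by (simp add: algebra_simps)
      qed
      ultimately show ?thesis
        using gam_square_diff[OF assms(2), of m] by (simp add: m)
    qed
    then show ?thesis using gn by (simp add: C_def W_def)
  qed
  define G where "G = mat n n (\<lambda>(p, q). v (min p q) * w (max p q) / W)"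
  have G: "G \<in> carrier_mat n n" by (simp add: G_def)
  have TG: "T_tilde n b bt * G = 1\<^sub>m n"
    unfolding G_def using T_tilde_mult_green[OF n2 W0 v1 v wn w W] .
  define H where "H = mat n n (\<lambda>(p, q). - ((-1) ^ (p + q) * G $$ (p, q)))"
  have H: "H \<in> carrier_mat n n" by (simp add: H_def)
  have TH: "T_tilde n (- b) (- bt) * H = 1\<^sub>m n"
    unfolding T_tilde_uminus H_def by (rule mult_mat_alternating_conj[OF T_tilde_carrier G TG])
  note inv = right_inverse_imp_mat_inverse[OF T_tilde_carrier G TG]
  note inv_plus = right_inverse_imp_mat_inverse[OF T_tilde_carrier H TH]
  have "inv_entry (T_tilde n b bt) i j
          = C * (gam b (n + 1 - i) + \<beta> * gam b (n - i)) * (gam b j + \<beta> * gam b (j - 1)) \<and>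
        inv_entry (T_tilde n b bt) i j
          = (-1) powi (int i - int j - 1) * inv_entry (T_tilde n (- b) (- bt)) i j"
    if ij: "1 \<le> j" "j \<le> i" "i \<le> n" for i j
  proof
    have "min (i - 1) (j - 1) = j - 1" "max (i - 1) (j - 1) = i - 1"
      "n - Suc 0 - (i - Suc 0) = n - i" "Suc (n - i) = n + 1 - i"
      using ij by auto
    then show "inv_entry (T_tilde n b bt) i j
        = C * (gam b (n + 1 - i) + \<beta> * gam b (n - i)) * (gam b j + \<beta> * gam b (j - 1))"
      using ij by (simp add: inv_entry_def inv G_def w_def v_def C)
    obtain d where d: "i = j + d" using ij le_Suc_ex by blast
    obtain l where l: "j = l + 1" using ij by (cases j) auto
    \<comment> \<open>The exponent is -1 when \<open>i = j\<close>, hence \<open>powi\<close>. Both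
      signs depend only on the parity of \<open>d\<close>, because
      \<open>i - 1 + (j - 1) = d + 2 * l\<close>; the two minus signs cancel.\<close>
    have "(-1 :: real) powi (int i - int j - 1) = - ((-1) ^ d)"
      by (simp add: d power_int_diff)
    moreover have "(-1 :: real) ^ (i - 1 + (j - 1)) = (-1) ^ d"
      by (simp add: d l power_add flip: power_mult_distrib)
    ultimately show "inv_entry (T_tilde n b bt) i j
        = (-1) powi (int i - int j - 1) * inv_entry (T_tilde n (- b) (- bt)) i j"
      using ij by (simp add: inv_entry_def inv inv_plus H_def flip: power_mult_distrib mult.assoc)
  qed
  then show ?thesis
    using inv_plus(1) unfolding Let_def \<beta>_def[symmetric] C_def[symmetric] by metis
qed

end
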